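(* Let $k\ge1$ be an integer, $0<q<\infty$, and $f\in C_c^k(\mathbb{R}^n)$. Then, for every $x\in\mathbb{R}^n$, $$\lim_{s\to1^-}\bigl(q(1-s)\bigr)^{1/q}\mathcal D_{s,q}^{(k)}f(x)=\mathcal A_{n,k,q}(D^kf(x)).$$
   Context: For $h\in\mathbb{R}^n$, $\Delta_h^kf(x):=\sum_{j=0}^k(-1)^{k-j}\binom kj f(x+jh)$, and for $0<s<1$, $$\mathcal D_{s,q}^{(k)}f(x):=\left(\int_{\mathbb{R}^n}\frac{|\Delta_h^kf(x)|^q}{|h|^{n+(k-1+s)q}}\,dh\right)^{1/q}.$$ $D^kf(x)$ is the symmetric $k$-linear form $D^kf(x)[v_1,\dots,v_k]=\sum_{i_1,\dots,i_k=1}^n\partial_{i_1}\cdots\partial_{i_k}f(x)(v_1)_{i_1}\cdots(v_k)_{i_k}$. For a symmetric $k$-linear form $A$ on $\mathbb{R}^n$, $A[v^k]:=A[v,\dots,v]$ and $\mathcal A_{n,k,q}(A):=\left(\int_{\mathbb S^{n-1}}|A[\theta^k]|^q\,d\theta\right)^{1/q}$, with $d\theta$ surface measure. *)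

theory Defs
  imports "HOL-Analysis.Analysis"
begin

definition partial_derivative :: "'n::finite \<Rightarrow> (real^'n \<Rightarrow> real) \<Rightarrow> real^'n \<Rightarrow> real" where
  "partial_derivative i f x = deriv (\<lambda>t. f (x + t *\<^sub>R axis i 1)) 0"

text \<open>A list \<open>[i\<^sub>1, \<dots>, i\<^sub>k]\<close> of indices stands for \<open>\<partial>\<^bsub>i\<^sub>1\<^esub> \<cdots> \<partial>\<^bsub>i\<^sub>k\<^esub> f\<close>.\<close>

definition partial_derivatives :: "'n::finite list \<Rightarrow> (real^'n \<Rightarrow> real) \<Rightarrow> real^'n \<Rightarrow> real" where
  "partial_derivatives is f = foldr partial_derivative is f"

definition Ck :: "nat \<Rightarrow> (real^'n::finite \<Rightarrow> real) \<Rightarrow> bool" where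
  "Ck k f \<longleftrightarrow>
    (\<forall>is. length is < k \<longrightarrow>
       (\<forall>i x. (\<lambda>t. partial_derivatives is f (x + t *\<^sub>R axis i 1)) differentiable (at (0::real)))) \<and>
    (\<forall>is. length is \<le> k \<longrightarrow> continuous_on UNIV (partial_derivatives is f))"

definition Ckc :: "nat \<Rightarrow> (real^'n::finite \<Rightarrow> real) \<Rightarrow> bool" where
  "Ckc k f \<longleftrightarrow> Ck k f \<and> compact (closure {x. f x \<noteq> 0})"

text \<open>A \<open>k\<close>-linear form on \<open>\<real>\<^sup>n\<close> is represented by its values on lists of \<open>k\<close> vectors.\<close>

definition derivative_form ::
  "nat \<Rightarrow> (real^'n::finite \<Rightarrow> real) \<Rightarrow> real^'n \<Rightarrow> (real^'n) list \<Rightarrow> real" where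
  "derivative_form k f x vs =
     (\<Sum>is | length is = k. partial_derivatives is f x * (\<Prod>j<k. (vs ! j) $ (is ! j)))"

definition finite_difference :: "nat \<Rightarrow> real^'n::finite \<Rightarrow> (real^'n \<Rightarrow> real) \<Rightarrow> real^'n \<Rightarrow> real" where
  "finite_difference k h f x =
     (\<Sum>j\<le>k. (-1) ^ (k - j) * real (k choose j) * f (x + real j *\<^sub>R h))"

text \<open>
  Surface measure on the unit sphere, by polar coordinates: the measure of \<open>E\<close> is \<open>n\<close> times the
  Lebesgue measure of the cone \<open>{r\<theta> | 0 < r \<le> 1, \<theta> \<in> E}\<close> (see \<open>emeasure_sphere_measure\<close> below).
  For \<open>n = 1\<close> this is the counting measure on \<open>{-1, 1}\<close>.
\<close>

definition sphere_measure :: "(real^'n::finite) measure" where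
  "sphere_measure = scale_measure (of_nat CARD('n))
     (distr (restrict_space lborel (cball 0 1 - {0})) (restrict_space borel (sphere 0 1)) sgn)"

lemma emeasure_sphere_measure:
  fixes E :: "(real^'n::finite) set"
  assumes E: "E \<in> sets borel" "E \<subseteq> sphere 0 1"
  shows "emeasure sphere_measure E =
    of_nat CARD('n) * emeasure lborel {r *\<^sub>R \<theta> | r \<theta>. 0 < r \<and> r \<le> 1 \<and> \<theta> \<in> E}"
proof -
  let ?B = "cball 0 1 - {0} :: (real^'n) set"
  have B: "?B \<in> sets borel" by auto
  have "sgn \<in> borel_measurable (borel :: (real^'n) measure)"
    unfolding sgn_div_norm[abs_def] by measurable
  then have sgn: "sgn \<in> restrict_space lborel ?B \<rightarrow>\<^sub>M restrict_space borel (sphere 0 1)"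
    by (intro measurable_restrict_space2 measurable_restrict_space1)
       (auto simp: space_restrict_space norm_sgn)
  have cone: "sgn -` E \<inter> ?B = {r *\<^sub>R \<theta> | r \<theta>. 0 < r \<and> r \<le> 1 \<and> \<theta> \<in> E}"
  proof (intro equalityI subsetI)
    fix x assume x: "x \<in> sgn -` E \<inter> ?B"
    then have "x = norm x *\<^sub>R sgn x" by (simp add: sgn_div_norm)
    with x show "x \<in> {r *\<^sub>R \<theta> | r \<theta>. 0 < r \<and> r \<le> 1 \<and> \<theta> \<in> E}"
      by (intro CollectI exI[of _ "norm x"] exI[of _ "sgn x"]) auto
  next
    fix x assume "x \<in> {r *\<^sub>R \<theta> | r \<theta>. 0 < r \<and> r \<le> 1 \<and> \<theta> \<in> E}"
    then obtain r \<theta> where "x = r *\<^sub>R \<theta>" "0 < r" "r \<le> 1" "\<theta> \<in> E" by blast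
    moreover from this E(2) have "norm \<theta> = 1" by auto
    ultimately show "x \<in> sgn -` E \<inter> ?B" by (auto simp: sgn_div_norm)
  qed
  have "emeasure (restrict_space lborel ?B) (sgn -` E \<inter> ?B) = emeasure lborel (sgn -` E \<inter> ?B)"
    using B by (intro emeasure_restrict_space) auto
  moreover have "E \<in> sets (restrict_space borel (sphere 0 1))"
    using E by (auto simp: sets_restrict_space_iff)
  ultimately show ?thesis
    by (simp add: sphere_measure_def emeasure_distr[OF sgn] space_restrict_space cone)
qed

text \<open>Both integrals take values in \<open>[0,\<infinity>]\<close>; \<open>ennreal_root q\<close> is \<open>t \<mapsto> t\<^bsup>1/q\<^esup>\<close> there, for \<open>q > 0\<close>.\<close>

definition ennreal_root :: "real \<Rightarrow> ennreal \<Rightarrow> ennreal" where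
  "ennreal_root q t = (if t = \<infinity> then \<infinity> else ennreal (enn2real t powr (1 / q)))"

definition form_norm :: "nat \<Rightarrow> real \<Rightarrow> ((real^'n::finite) list \<Rightarrow> real) \<Rightarrow> ennreal" where
  "form_norm k q A =
     ennreal_root q (\<integral>\<^sup>+\<theta>. ennreal (\<bar>A (replicate k \<theta>)\<bar> powr q) \<partial>sphere_measure)"

definition fractional_derivative ::
  "nat \<Rightarrow> real \<Rightarrow> real \<Rightarrow> (real^'n::finite \<Rightarrow> real) \<Rightarrow> real^'n \<Rightarrow> ennreal" where
  "fractional_derivative k s q f x =
     ennreal_root q (\<integral>\<^sup>+h. ennreal (\<bar>finite_difference k h f x\<bar> powr q /
        norm h powr (real CARD('n) + (real k - 1 + s) * q)) \<partial>lborel)"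

end

theory Submission
  imports Defs
begin

text \<open>
  By a mean value theorem for finite differences, \<open>\<Delta>\<^sub>h\<^sup>k f(x) = D\<^sup>kf(x + \<tau>h)[h\<^sup>k]\<close> with
  \<open>0 \<le> \<tau> \<le> k\<close>, so \<open>|\<Delta>\<^sub>h\<^sup>k f(x)|\<^sup>q / |h|\<^bsup>kq\<^esup>\<close> is uniformly close to \<open>|D\<^sup>kf(x)[\<theta>\<^sup>k]|\<^sup>q\<close>,
  \<open>\<theta> = h/|h|\<close>, for small \<open>h\<close>. With \<open>p = q(1 - s)\<close> the remaining weight is \<open>p |h|\<^bsup>p - n\<^esup>\<close>. It has
  mass \<open>\<delta>\<^sup>p\<close> times surface measure on the directions in the ball of radius \<open>\<delta>\<close>, and the integral
  outside the ball is \<open>O(p)\<close> because \<open>f\<close> is bounded.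
\<close>

section \<open>Finite differences and the derivative form\<close>

text \<open>Pascal's rule splits each coefficient in two. One half is the difference of order
  \<open>k\<close> of the shifted sequence; the other, whose top term vanishes because
  \<open>k choose Suc k\<close> is 0, is minus that of \<open>a\<close>. This drives the induction
  on the order.\<close>

lemma binomial_difference_Suc:
  fixes a :: "nat \<Rightarrow> real"
  shows "(\<Sum>j\<le>Suc k. (-1) ^ (Suc k - j) * real (Suc k choose j) * a j) =
         (\<Sum>j\<le>k. (-1) ^ (k - j) * real (k choose j) * (a (Suc j) - a j))"
proof -
  have "(\<Sum>j\<le>Suc k. (-1) ^ (Suc k - j) * real (Suc k choose j) * a j) =
      (-1) ^ Suc k * a 0 + (\<Sum>j\<le>k. (-1) ^ (k - j) * real (Suc k choose Suc j) * a (Suc j))"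
    by (subst sum.atMost_Suc_shift) simp
  also have "\<dots> = (\<Sum>j\<le>k. (-1) ^ (k - j) * real (k choose j) * a (Suc j)) +
      ((-1) ^ Suc k * a 0 + (\<Sum>j\<le>k. (-1) ^ (k - j) * real (k choose Suc j) * a (Suc j)))"
    by (simp add: sum.distrib[symmetric] algebra_simps)
  also have "(-1) ^ Suc k * a 0 + (\<Sum>j\<le>k. (-1) ^ (k - j) * real (k choose Suc j) * a (Suc j)) =
      (\<Sum>j\<le>Suc k. (-1) ^ (Suc k - j) * real (k choose j) * a j)"
    by (subst sum.atMost_Suc_shift) simp
  also have "\<dots> = - (\<Sum>j\<le>k. (-1) ^ (k - j) * real (k choose j) * a j)"
    by (simp add: sum_negf[symmetric] Suc_diff_le)
  finally show ?thesis
    by (simp add: algebra_simps sum_subtractf)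
qed

text \<open>Here \<open>\<phi> m\<close> plays the role of the derivative of order \<open>m\<close>
  of \<open>\<phi> 0\<close>. The induction hypothesis is applied to the chain of first differences
  \<open>\<phi> m (t + 1) - \<phi> m t\<close>; one ordinary mean value step on
  \<open>[\<tau>, \<tau> + 1]\<close> then gains the last derivative and enlarges the range of the
  intermediate point by 1.\<close>

lemma finite_difference_mean_value:
  fixes \<phi> :: "nat \<Rightarrow> real \<Rightarrow> real"
  assumes "\<And>m t. m < k \<Longrightarrow> (\<phi> m has_real_derivative \<phi> (Suc m) t) (at t)"
  shows "\<exists>\<tau>\<in>{0..real k}. (\<Sum>j\<le>k. (-1) ^ (k - j) * real (k choose j) * \<phi> 0 (real j)) = \<phi> k \<tau>"
  using assms
proof (induction k arbitrary: \<phi>)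
  case 0
  then show ?case by simp
next
  case (Suc k)
  have "\<exists>\<tau>\<in>{0..real k}. (\<Sum>j\<le>k. (-1) ^ (k - j) * real (k choose j) *
      (\<phi> 0 (real j + 1) - \<phi> 0 (real j))) = \<phi> k (\<tau> + 1) - \<phi> k \<tau>"
  proof (rule Suc.IH[where \<phi> = "\<lambda>m t. \<phi> m (t + 1) - \<phi> m t"])
    fix m t
    assume m: "m < k"
    have "((\<lambda>t. \<phi> m (t + 1)) has_real_derivative \<phi> (Suc m) (t + 1)) (at t)"
      using Suc.prems[of m "t + 1"] m by (simp add: DERIV_shift)
    then show "((\<lambda>t. \<phi> m (t + 1) - \<phi> m t) has_real_derivative
        \<phi> (Suc m) (t + 1) - \<phi> (Suc m) t) (at t)"
      using Suc.prems[of m t] m by (intro DERIV_diff) auto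
  qed
  then obtain \<tau> where \<tau>: "\<tau> \<in> {0..real k}"
    "(\<Sum>j\<le>k. (-1) ^ (k - j) * real (k choose j) *
      (\<phi> 0 (real j + 1) - \<phi> 0 (real j))) = \<phi> k (\<tau> + 1) - \<phi> k \<tau>" by blast
  obtain z where z: "\<tau> < z" "z < \<tau> + 1" "\<phi> k (\<tau> + 1) - \<phi> k \<tau> = (\<tau> + 1 - \<tau>) * \<phi> (Suc k) z"
    using MVT2[of \<tau> "\<tau> + 1" "\<phi> k" "\<phi> (Suc k)"] Suc.prems[of k] by auto
  have "(\<Sum>j\<le>Suc k. (-1) ^ (Suc k - j) * real (Suc k choose j) * \<phi> 0 (real j)) = \<phi> (Suc k) z"
    unfolding binomial_difference_Suc using \<tau>(2) z(3) by (simp add: add.commute)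
  then show ?case using \<tau>(1) z by (intro bexI[of _ z]) auto
qed

section \<open>Directional derivatives from continuous partial derivatives\<close>

text \<open>The increment is followed one coordinate at a time, with \<open>S\<close> the set of
  coordinates already moved. Bounding the total length of the path, not only its endpoint, keeps
  every intermediate point in the ball where \<open>close\<close> applies.\<close>

lemma increment_approx_by_partial_derivatives:
  fixes g :: "real^'n::finite \<Rightarrow> real"
  assumes diff: "\<And>i y. (\<lambda>t. g (y + t *\<^sub>R axis i 1)) differentiable (at (0::real))"
    and close: "\<And>i z. dist z x < \<delta> \<Longrightarrow> \<bar>partial_derivative i g z - c i\<bar> \<le> \<epsilon>"
    and "finite S"
    and "dist y x + (\<Sum>i\<in>S. \<bar>v i\<bar>) < \<delta>"
  shows "\<bar>g (y + (\<Sum>i\<in>S. v i *\<^sub>R axis i 1)) - g y - (\<Sum>i\<in>S. c i * v i)\<bar> \<le> \<epsilon> * (\<Sum>i\<in>S. \<bar>v i\<bar>)"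
  using assms(3,4)
proof (induction S)
  case empty
  then show ?case by simp
next
  case (insert i S)
  define w where "w = y + (\<Sum>i\<in>S. v i *\<^sub>R axis i (1::real))"
  have "norm (\<Sum>i\<in>S. v i *\<^sub>R axis i (1::real)) \<le> (\<Sum>i\<in>S. \<bar>v i\<bar>)"
    by (rule order_trans[OF norm_sum]) simp
  then have w: "dist w x \<le> dist y x + (\<Sum>i\<in>S. \<bar>v i\<bar>)"
    unfolding w_def using norm_triangle_ineq[of "y - x" "\<Sum>i\<in>S. v i *\<^sub>R axis i (1::real)"]
    by (simp add: dist_norm algebra_simps)
  have deriv: "((\<lambda>t. g (w + t *\<^sub>R axis i 1) - c i * t) has_derivative
      (\<lambda>u. u * (partial_derivative i g (w + t *\<^sub>R axis i 1) - c i))) (at t within T)" for t T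
  proof -
    have "((\<lambda>u. g ((w + t *\<^sub>R axis i 1) + u *\<^sub>R axis i 1)) has_real_derivative
        partial_derivative i g (w + t *\<^sub>R axis i 1)) (at 0)"
      unfolding partial_derivative_def using diff[of "w + t *\<^sub>R axis i 1" i]
      by (simp add: DERIV_deriv_iff_real_differentiable)
    then have "((\<lambda>u. g (w + (t + u) *\<^sub>R axis i 1)) has_real_derivative
        partial_derivative i g (w + t *\<^sub>R axis i 1)) (at 0)"
      by (simp add: algebra_simps)
    then have "((\<lambda>u. g (w + u *\<^sub>R axis i 1)) has_real_derivative
        partial_derivative i g (w + t *\<^sub>R axis i 1)) (at t)"
      using DERIV_at_within_shift[of "\<lambda>u. g (w + u *\<^sub>R axis i 1)" _ t 0 UNIV]
      by simp
    then have "((\<lambda>t. g (w + t *\<^sub>R axis i 1) - c i * t) has_real_derivative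
        (partial_derivative i g (w + t *\<^sub>R axis i 1) - c i)) (at t)"
      by (auto intro!: derivative_eq_intros)
    then have "((\<lambda>t. g (w + t *\<^sub>R axis i 1) - c i * t) has_derivative
        (*) (partial_derivative i g (w + t *\<^sub>R axis i 1) - c i)) (at t within T)"
      unfolding has_field_derivative_def by (rule has_derivative_at_withinI)
    then show ?thesis by (simp add: mult.commute[of _ "_ - _"])
  qed
  \<comment> \<open>Mean value inequality along coordinate \<open>i\<close>: subtracting the linear
    part \<open>c i * t\<close> leaves a function whose derivative is at most
    \<open>\<epsilon>\<close> on the segment.\<close>
  have "norm ((g (w + v i *\<^sub>R axis i 1) - c i * v i) - (g (w + 0 *\<^sub>R axis i 1) - c i * 0))
      \<le> \<epsilon> * norm (v i - 0)"
  proof (rule differentiable_bound[OF _ deriv])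
    show "convex (closed_segment 0 (v i))" by (rule convex_closed_segment)
    fix t assume "t \<in> closed_segment 0 (v i)"
    then have "\<bar>t\<bar> \<le> \<bar>v i\<bar>" by (auto simp: closed_segment_eq_real_ivl split: if_splits)
    then have "dist (w + t *\<^sub>R axis i 1) x < \<delta>"
      using w insert.prems insert.hyps norm_triangle_ineq[of "w - x" "t *\<^sub>R axis i 1"]
      by (simp add: dist_norm algebra_simps)
    then have "\<bar>partial_derivative i g (w + t *\<^sub>R axis i 1) - c i\<bar> \<le> \<epsilon>" by (rule close)
    then show "onorm (\<lambda>u. u * (partial_derivative i g (w + t *\<^sub>R axis i 1) - c i)) \<le> \<epsilon>"
      by (intro onorm_le) (metis abs_ge_zero mult.commute mult_right_mono norm_mult real_norm_def)
  qed auto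
  then have step: "\<bar>g (w + v i *\<^sub>R axis i 1) - g w - c i * v i\<bar> \<le> \<epsilon> * \<bar>v i\<bar>"
    by (simp add: algebra_simps)
  have IH: "\<bar>g w - g y - (\<Sum>i\<in>S. c i * v i)\<bar> \<le> \<epsilon> * (\<Sum>i\<in>S. \<bar>v i\<bar>)"
    unfolding w_def using insert.prems insert.hyps by (intro insert.IH) (auto intro: le_less_trans)
  have eq: "y + (\<Sum>i\<in>insert i S. v i *\<^sub>R axis i 1) = w + v i *\<^sub>R axis i 1"
    using insert.hyps by (simp add: w_def add_ac)
  show ?case
    unfolding eq unfolding sum.insert[OF insert.hyps] distrib_left using step IH by linarith
qed

text \<open>Freezing the partial derivatives at the base point \<open>y\<close>, the coordinatewise
  estimate bounds the error of the linear approximation by an arbitrarily small multiple of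
  \<open>\<bar>u\<bar>\<close>, which is differentiability along the line.\<close>

lemma directional_derivative_partials:
  fixes g :: "real^'n::finite \<Rightarrow> real"
  assumes diff: "\<And>i y. (\<lambda>t. g (y + t *\<^sub>R axis i 1)) differentiable (at (0::real))"
    and cont: "\<And>i. continuous_on UNIV (partial_derivative i g)"
  shows "((\<lambda>t. g (x + t *\<^sub>R h)) has_real_derivative
    (\<Sum>i\<in>UNIV. partial_derivative i g (x + t *\<^sub>R h) * h $ i)) (at t)"
proof -
  define y where "y = x + t *\<^sub>R h"
  define c where "c i = partial_derivative i g y" for i
  \<comment> \<open>The summand 1 keeps the divisor \<open>H\<close> positive when
    \<open>h = 0\<close>; the 1-norm of \<open>h\<close> itself is \<open>H - 1\<close>.\<close>
  define H where "H = (\<Sum>i\<in>UNIV. \<bar>h $ i\<bar>) + 1"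
  have H: "H > 0" unfolding H_def by (intro add_nonneg_pos sum_nonneg) auto
  have "(\<lambda>u. (g (x + (t + u) *\<^sub>R h) - g (x + t *\<^sub>R h)) / u) \<midarrow>0\<rightarrow> (\<Sum>i\<in>UNIV. c i * h $ i)"
  proof (rule LIM_I)
    fix e :: real assume e: "e > 0"
    define \<epsilon> where "\<epsilon> = e / (2 * H)"
    have \<epsilon>: "\<epsilon> > 0" using e H by (simp add: \<epsilon>_def)
    have "\<forall>i. \<exists>d>0. \<forall>z. dist z y < d \<longrightarrow> dist (partial_derivative i g z) (c i) < \<epsilon>"
      using cont \<epsilon> unfolding c_def continuous_on_iff by blast
    then obtain d where d: "\<And>i. d i > 0"
      "\<And>i z. dist z y < d i \<Longrightarrow> dist (partial_derivative i g z) (c i) < \<epsilon>" by metis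
    define \<delta> where "\<delta> = Min (range d)"
    have \<delta>: "\<delta> > 0" "\<delta> \<le> d i" for i using d by (auto simp: \<delta>_def)
    have close: "\<bar>partial_derivative i g z - c i\<bar> \<le> \<epsilon>" if "dist z y < \<delta>" for i z
      using d(2)[of z i] that \<delta>(2)[of i] by (simp add: dist_real_def)
    show "\<exists>r>0. \<forall>u. u \<noteq> 0 \<and> norm (u - 0) < r \<longrightarrow>
      norm ((g (x + (t + u) *\<^sub>R h) - g (x + t *\<^sub>R h)) / u - (\<Sum>i\<in>UNIV. c i * h $ i)) < e"
    proof (intro exI[of _ "\<delta> / H"] conjI allI impI)
      show "0 < \<delta> / H" using \<delta> H by simp
      fix u :: real assume u: "u \<noteq> 0 \<and> norm (u - 0) < \<delta> / H"
      have sum: "(\<Sum>i\<in>UNIV. \<bar>u * h $ i\<bar>) = \<bar>u\<bar> * (H - 1)"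
        by (simp add: H_def abs_mult sum_distrib_left)
      have "(\<Sum>i\<in>UNIV. \<bar>u * h $ i\<bar>) \<le> \<bar>u\<bar> * H"
        unfolding sum by (intro mult_left_mono) auto
      also have "\<dots> < \<delta>" using u H by (simp add: field_simps)
      finally have "dist y y + (\<Sum>i\<in>UNIV. \<bar>u * h $ i\<bar>) < \<delta>" by simp
      from increment_approx_by_partial_derivatives[OF diff close finite this]
      have "\<bar>g (y + (\<Sum>i\<in>UNIV. (u * h $ i) *\<^sub>R axis i 1)) - g y - (\<Sum>i\<in>UNIV. c i * (u * h $ i))\<bar>
          \<le> \<epsilon> * (\<bar>u\<bar> * (H - 1))"
        unfolding sum by simp
      moreover have "(\<Sum>i\<in>UNIV. (u * h $ i) *\<^sub>R axis i 1) = u *\<^sub>R h"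
        using basis_expansion[of h]
        by (simp add: scalar_mult_eq_scaleR scaleR_scaleR[symmetric] scaleR_sum_right[symmetric]
          del: scaleR_scaleR)
      moreover have "y + u *\<^sub>R h = x + (t + u) *\<^sub>R h" by (simp add: y_def algebra_simps)
      moreover have "(\<Sum>i\<in>UNIV. c i * (u * h $ i)) = u * (\<Sum>i\<in>UNIV. c i * h $ i)"
        by (simp add: sum_distrib_left algebra_simps)
      ultimately have "\<bar>(g (x + (t + u) *\<^sub>R h) - g (x + t *\<^sub>R h)) - u * (\<Sum>i\<in>UNIV. c i * h $ i)\<bar>
          \<le> \<epsilon> * (\<bar>u\<bar> * (H - 1))" by (simp only: y_def[symmetric])
      also have "\<dots> < \<bar>u\<bar> * e"
      proof -
        have "\<epsilon> * (H - 1) < e" using H e by (simp add: \<epsilon>_def field_simps add_pos_pos)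
        then show ?thesis using u by (simp add: mult.left_commute)
      qed
      finally have "\<bar>(g (x + (t + u) *\<^sub>R h) - g (x + t *\<^sub>R h)) - u * (\<Sum>i\<in>UNIV. c i * h $ i)\<bar> / \<bar>u\<bar> < e"
        using u by (simp add: field_simps)
      then show "norm ((g (x + (t + u) *\<^sub>R h) - g (x + t *\<^sub>R h)) / u - (\<Sum>i\<in>UNIV. c i * h $ i)) < e"
        using u unfolding abs_divide[symmetric] by (simp add: diff_divide_distrib)
    qed
  qed
  then show ?thesis by (simp add: DERIV_def c_def y_def)
qed

section \<open>The derivative form on the diagonal\<close>

lemma finite_lists_of_length: "finite {is :: 'a::finite list. length is = m}"
  using finite_lists_length_eq[of "UNIV :: 'a set" m] by simp

lemma derivative_form_replicate:
  "derivative_form m f y (replicate m h) =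
     (\<Sum>is | length is = m. partial_derivatives is f y * (\<Prod>i\<leftarrow>is. h $ i))"
  unfolding derivative_form_def
  by (intro sum.cong refl arg_cong2[where f = "(*)"])
     (simp add: prod.list_conv_set_nth atLeast0LessThan)

text \<open>An index list of length \<open>Suc m\<close> is uniquely \<open>i # is\<close>, and its
  head is the outermost derivative. Grouping by the tail exhibits the inner sum as the directional
  derivative of \<open>partial_derivatives is f\<close> along \<open>h\<close>.\<close>

lemma derivative_form_replicate_Suc:
  fixes f :: "real^'n::finite \<Rightarrow> real"
  shows "derivative_form (Suc m) f y (replicate (Suc m) h) =
     (\<Sum>is | length is = m. (\<Sum>i\<in>UNIV. partial_derivative i (partial_derivatives is f) y * h $ i)
        * (\<Prod>i\<leftarrow>is. h $ i))"
proof -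
  have "bij_betw (\<lambda>(is, i). i # is) ({is. length is = m} \<times> (UNIV :: 'n set)) {is. length is = Suc m}"
    by (rule bij_betw_byWitness[where f' = "\<lambda>l. (tl l, hd l)"])
       (auto simp: length_Suc_conv)
  then show ?thesis
    unfolding derivative_form_replicate
    by (subst sum.reindex_bij_betw[symmetric], assumption)
       (simp add: sum.cartesian_product case_prod_unfold sum_distrib_right
         partial_derivatives_def mult.assoc)
qed

text \<open>Termwise differentiation along the line through \<open>x\<close> in direction
  \<open>h\<close>. It makes the diagonal forms of orders 0 to \<open>k\<close> a chain to which the
  mean value theorem for finite differences applies.\<close>

lemma derivative_form_has_real_derivative:
  fixes f :: "real^'n::finite \<Rightarrow> real"
  assumes "Ck k f" "m < k"
  shows "((\<lambda>t. derivative_form m f (x + t *\<^sub>R h) (replicate m h)) has_real_derivative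
    derivative_form (Suc m) f (x + t *\<^sub>R h) (replicate (Suc m) h)) (at t)"
  unfolding derivative_form_replicate_Suc unfolding derivative_form_replicate
proof (intro DERIV_sum DERIV_cmult_right directional_derivative_partials)
  fix "is" :: "'n list" and i y
  assume len: "is \<in> {is. length is = m}"
  with assms show "(\<lambda>t. partial_derivatives is f (y + t *\<^sub>R axis i 1)) differentiable (at 0)"
    by (auto simp: Ck_def)
  have "continuous_on UNIV (partial_derivatives (i # is) f)"
    using assms len unfolding Ck_def by auto
  then show "continuous_on UNIV (partial_derivative i (partial_derivatives is f))"
    by (simp add: partial_derivatives_def)
qed

lemma finite_difference_eq_derivative_form:
  fixes f :: "real^'n::finite \<Rightarrow> real"
  assumes "Ck k f"
  shows "\<exists>\<tau>\<in>{0..real k}. finite_difference k h f x = derivative_form k f (x + \<tau> *\<^sub>R h) (replicate k h)"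
proof -
  have "derivative_form 0 f y [] = f y" for y
    by (simp add: derivative_form_def partial_derivatives_def)
  then show ?thesis
    using finite_difference_mean_value
      [of k "\<lambda>m t. derivative_form m f (x + t *\<^sub>R h) (replicate m h)",
       OF derivative_form_has_real_derivative[OF assms]]
    by (simp add: finite_difference_def)
qed

lemma derivative_form_replicate_scaleR:
  "derivative_form m f y (replicate m (r *\<^sub>R h)) = r ^ m * derivative_form m f y (replicate m h)"
proof -
  have "(\<Prod>i\<leftarrow>is. (r *\<^sub>R h) $ i) = r ^ length is * (\<Prod>i\<leftarrow>is. h $ i)" for "is"
    by (induction "is") auto
  then show ?thesis
    by (simp add: derivative_form_replicate sum_distrib_left mult.left_commute)
qed

lemma continuous_on_derivative_form_replicate:
  fixes f :: "real^'n::finite \<Rightarrow> real"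
  shows "continuous_on UNIV (\<lambda>h. derivative_form m f y (replicate m h))"
  unfolding derivative_form_def
proof (intro continuous_intros)
  fix "is" :: "'n list" and j
  assume "j \<in> {..<m}"
  then show "continuous_on UNIV (\<lambda>h :: real^'n. replicate m h ! j)"
    by (intro continuous_on_eq[OF continuous_on_id]) simp
qed

text \<open>The intermediate point \<open>x + \<tau> *\<^sub>R h\<close> lies within
  \<open>k * norm h\<close> of \<open>x\<close>, so the finitely many partial derivatives of order
  \<open>k\<close>, being continuous, barely differ from their values at \<open>x\<close>; each is
  multiplied by a product of size at most \<open>norm h ^ k\<close>.\<close>

lemma finite_difference_asymp_derivative_form:
  fixes f :: "real^'n::finite \<Rightarrow> real"
  assumes "Ck k f" "e > 0"
  shows "\<exists>\<delta>>0. \<forall>h. norm h \<le> \<delta> \<longrightarrow>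
    \<bar>finite_difference k h f x - derivative_form k f x (replicate k h)\<bar> \<le> e * norm h ^ k"
proof -
  define N where "N = real (card {is :: 'n list. length is = k}) + 1"
  define \<epsilon> where "\<epsilon> = e / N"
  have N: "N > 0" by (simp add: N_def add_nonneg_pos)
  have \<epsilon>: "\<epsilon> > 0" using assms N by (simp add: \<epsilon>_def)
  have "\<exists>d>0. \<forall>y. dist y x < d \<longrightarrow>
      dist (partial_derivatives is f y) (partial_derivatives is f x) < \<epsilon>" if "length is = k" for "is"
  proof -
    have "continuous_on UNIV (partial_derivatives is f)"
      using assms that unfolding Ck_def by auto
    then show ?thesis using \<epsilon> unfolding continuous_on_iff by blast
  qed
  then obtain d where d: "\<And>is. length is = k \<Longrightarrow> d is > 0"
    "\<And>is y. length is = k \<Longrightarrow> dist y x < d is \<Longrightarrow>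
      dist (partial_derivatives is f y) (partial_derivatives is f x) < \<epsilon>" by metis
  define r where "r = Min (d ` {is. length is = k})"
  have ne: "{is :: 'n list. length is = k} \<noteq> {}"
    using length_replicate[of k "undefined :: 'n"] by blast
  have r: "r > 0" using d(1) ne by (auto simp: r_def finite_lists_of_length)
  have rd: "r \<le> d is" if "length is = k" for "is"
    using that by (auto simp: r_def finite_lists_of_length)
  show ?thesis
  \<comment> \<open>Dividing by \<open>k + 1\<close> covers \<open>k = 0\<close> and makes
    \<open>\<tau> * norm h < r\<close> strict, since \<open>\<tau> \<le> k\<close>.\<close>
  proof (intro exI[of _ "r / (real k + 1)"] conjI allI impI)
    show "0 < r / (real k + 1)" using r by (simp add: add_nonneg_pos)
    fix h :: "real^'n" assume h: "norm h \<le> r / (real k + 1)"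
    obtain \<tau> where \<tau>: "\<tau> \<in> {0..real k}"
      "finite_difference k h f x = derivative_form k f (x + \<tau> *\<^sub>R h) (replicate k h)"
      using finite_difference_eq_derivative_form[OF assms(1)] by blast
    have "\<tau> * norm h \<le> real k * (r / (real k + 1))"
      using \<tau>(1) h by (intro mult_mono) auto
    also have "\<dots> < r" using r by (simp add: field_simps)
    finally have dist: "dist (x + \<tau> *\<^sub>R h) x < r" using \<tau>(1) by (simp add: dist_norm)
    have prod: "\<bar>\<Prod>i\<leftarrow>is. h $ i\<bar> \<le> norm h ^ length is" for "is"
      by (induction "is") (auto simp: abs_mult intro!: mult_mono component_le_norm_cart)
    have "\<bar>finite_difference k h f x - derivative_form k f x (replicate k h)\<bar> =
      \<bar>\<Sum>is | length is = k. (partial_derivatives is f (x + \<tau> *\<^sub>R h) - partial_derivatives is f x)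
         * (\<Prod>i\<leftarrow>is. h $ i)\<bar>"
      by (simp add: \<tau>(2) derivative_form_replicate sum_subtractf algebra_simps)
    also have "\<dots> \<le> (\<Sum>is :: 'n list | length is = k. \<epsilon> * norm h ^ k)"
    proof (intro order_trans[OF sum_abs] sum_mono)
      fix "is" :: "'n list" assume "is \<in> {is. length is = k}"
      then have len: "length is = k" by simp
      have "\<bar>partial_derivatives is f (x + \<tau> *\<^sub>R h) - partial_derivatives is f x\<bar> \<le> \<epsilon>"
        using d(2)[OF len, of "x + \<tau> *\<^sub>R h"] dist rd[OF len] by (simp add: dist_real_def)
      then show "\<bar>(partial_derivatives is f (x + \<tau> *\<^sub>R h) - partial_derivatives is f x)
          * (\<Prod>i\<leftarrow>is. h $ i)\<bar> \<le> \<epsilon> * norm h ^ k"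
        using prod[of "is"] len by (auto simp: abs_mult intro!: mult_mono)
    qed
    also have "\<dots> = (N - 1) * \<epsilon> * norm h ^ k" by (simp add: N_def)
    also have "\<dots> \<le> e * norm h ^ k"
    proof (rule mult_right_mono)
      show "(N - 1) * \<epsilon> \<le> e" using N assms by (simp add: \<epsilon>_def field_simps)
    qed simp
    finally show "\<bar>finite_difference k h f x - derivative_form k f x (replicate k h)\<bar> \<le> e * norm h ^ k" .
  qed
qed

section \<open>Integrals against powers of the norm\<close>

text \<open>The dilation by \<open>t\<close> maps the unit ball to the ball of radius
  \<open>t\<close>, fixes \<open>G\<close> and scales Lebesgue measure by the power
  \<open>t ^ DIM('a)\<close>.\<close>

lemma nn_integral_cball_homogeneous:
  fixes G :: "'a::euclidean_space \<Rightarrow> ennreal"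
  assumes [measurable]: "G \<in> borel_measurable borel"
    and hom: "\<And>c h. c > 0 \<Longrightarrow> G (c *\<^sub>R h) = G h" and t: "t > 0"
  shows "(\<integral>\<^sup>+h. G h * indicator {h. norm h \<le> t} h \<partial>lborel) =
    ennreal (t ^ DIM('a)) * (\<integral>\<^sup>+h. G h * indicator {h. norm h \<le> 1} h \<partial>lborel)"
proof -
  have "(\<integral>\<^sup>+h. G h * indicator {h. norm h \<le> t} h \<partial>lborel) =
     (\<integral>\<^sup>+h. ennreal (t ^ DIM('a)) * (G (t *\<^sub>R h) * indicator {h. norm h \<le> t} (t *\<^sub>R h)) \<partial>lborel)"
    using t by (subst lborel_affine[of t 0]) (simp_all add: nn_integral_density nn_integral_distr)
  also have "\<dots> = (\<integral>\<^sup>+h. ennreal (t ^ DIM('a)) * (G h * indicator {h. norm h \<le> 1} h) \<partial>lborel)"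
    using t by (intro nn_integral_cong) (simp add: hom indicator_def)
  finally show ?thesis by (simp add: nn_integral_cmult)
qed

text \<open>Layer-cake formula: away from the origin, \<open>norm h powr - b\<close> is the integral
  of \<open>b * t powr (- b - 1)\<close> over \<open>t \<ge> norm h\<close>, and Tonelli exchanges
  the integrals. Weighted integrals over the space thereby reduce to integrals over balls.\<close>

lemma nn_integral_norm_powr_layers:
  fixes G :: "'a::euclidean_space \<Rightarrow> ennreal"
  assumes [measurable]: "G \<in> borel_measurable borel" and b: "b > 0"
  shows "(\<integral>\<^sup>+h. G h * ennreal (norm h powr - b) \<partial>lborel) =
    (\<integral>\<^sup>+t. ennreal (b * t powr (- b - 1)) * (\<integral>\<^sup>+h. G h * indicator {h. norm h \<le> t} h \<partial>lborel) \<partial>lborel)"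
proof -
  have layer: "ennreal (r powr - b) =
      (\<integral>\<^sup>+t. ennreal (b * t powr (- b - 1)) * indicator {r..} t \<partial>lborel)" if "r > 0" for r
  proof -
    have "((\<lambda>t. b * t powr (- b - 1)) has_integral b * (- (r powr (- b - 1 + 1)) / (- b - 1 + 1))) {r..}"
      using b that by (intro has_integral_mult_right has_integral_powr_to_inf) auto
    then show ?thesis
      using b by (subst nn_integral_has_integral_lebesgue') auto
  qed
  have "(\<integral>\<^sup>+h. G h * ennreal (norm h powr - b) \<partial>lborel) =
    (\<integral>\<^sup>+h. (\<integral>\<^sup>+t. ennreal (b * t powr (- b - 1)) * (G h * indicator {h. norm h \<le> t} h) \<partial>lborel) \<partial>lborel)"
  proof (intro nn_integral_cong_AE, use AE_lborel_singleton[of "0::'a"] in eventually_elim)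
    case (elim h)
    have "G h * ennreal (norm h powr - b) =
        (\<integral>\<^sup>+t. G h * (ennreal (b * t powr (- b - 1)) * indicator {norm h..} t) \<partial>lborel)"
      using elim by (subst layer) (simp_all add: nn_integral_cmult)
    also have "\<dots> = (\<integral>\<^sup>+t. ennreal (b * t powr (- b - 1)) * (G h * indicator {h. norm h \<le> t} h) \<partial>lborel)"
      by (intro nn_integral_cong) (simp add: indicator_def mult_ac)
    finally show ?case .
  qed
  also have "\<dots> = (\<integral>\<^sup>+t. (\<integral>\<^sup>+h. ennreal (b * t powr (- b - 1)) * (G h * indicator {h. norm h \<le> t} h) \<partial>lborel) \<partial>lborel)"
    by (rule lborel_pair.Fubini'[symmetric]) measurable
  also have "\<dots> = (\<integral>\<^sup>+t. ennreal (b * t powr (- b - 1)) * (\<integral>\<^sup>+h. G h * indicator {h. norm h \<le> t} h \<partial>lborel) \<partial>lborel)"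
    by (intro nn_integral_cong nn_integral_cmult) measurable
  finally show ?thesis .
qed

text \<open>Layers with \<open>b = n - p\<close>, positive because \<open>p < n\<close>. The
  truncated ball integrals are \<open>min t d ^ n\<close> times the one over the unit ball, so only
  the integral of the explicit radial function \<open>w\<close> is left. The factor
  \<open>1 / p\<close> in the result is what multiplication by \<open>p\<close> later
  cancels.\<close>

lemma nn_integral_homogeneous_norm_powr_cball:
  fixes G :: "'a::euclidean_space \<Rightarrow> ennreal" and d p :: real
  assumes [measurable]: "G \<in> borel_measurable borel"
    and hom: "\<And>c h. c > 0 \<Longrightarrow> G (c *\<^sub>R h) = G h"
    and d: "d > 0" and p: "0 < p" "p < DIM('a)"
  shows "(\<integral>\<^sup>+h. G h * indicator {h. norm h \<le> d} h * ennreal (norm h powr (p - DIM('a))) \<partial>lborel) =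
    ennreal (DIM('a) * d powr p / p) * (\<integral>\<^sup>+h. G h * indicator {h. norm h \<le> 1} h \<partial>lborel)"
proof -
  define n where "n = DIM('a)"
  define b where "b = n - p"
  have b: "b > 0" using p by (simp add: b_def n_def)
  define C where "C = (\<integral>\<^sup>+h. G h * indicator {h. norm h \<le> 1} h \<partial>lborel)"
  define w where "w t = b * t powr (- b - 1) * min t d ^ n" for t
  have "((\<lambda>t. b * t powr (p - 1)) has_integral b * (d powr (p - 1 + 1) / (p - 1 + 1))) {0..d}"
    using p d by (intro has_integral_mult_right has_integral_powr_from_0) auto
  \<comment> \<open>Below \<open>d\<close> the function \<open>w\<close> is
    \<open>b * t powr (p - 1)\<close>; at \<open>t = 0\<close> both vanish by the convention that
    \<open>0 powr _\<close> is 0.\<close>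
  then have "(w has_integral b * d powr p / p) {0..d}"
  proof (rule has_integral_eq[rotated, THEN has_integral_eq_rhs])
    fix t assume t: "t \<in> {0..d}"
    show "b * t powr (p - 1) = w t"
    proof (cases "t = 0")
      case False
      then have "t powr (- b - 1) * t ^ n = t powr (p - 1)"
        using t by (simp add: powr_realpow[symmetric] powr_add[symmetric] b_def)
      then show ?thesis using t by (simp add: w_def min_absorb1)
    qed (simp add: w_def)
  qed simp
  moreover have "(w has_integral d powr p) {d..}"
  proof -
    have "((\<lambda>t. b * t powr (- b - 1) * d ^ n) has_integral
        b * (- (d powr (- b - 1 + 1)) / (- b - 1 + 1)) * d ^ n) {d..}"
      using b d by (intro has_integral_mult_left has_integral_mult_right has_integral_powr_to_inf) auto
    moreover have "b * (- (d powr (- b - 1 + 1)) / (- b - 1 + 1)) * d ^ n = d powr p"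
      using b d by (simp add: powr_realpow[symmetric] powr_add[symmetric]) (simp add: b_def)
    moreover have "b * t powr (- b - 1) * d ^ n = w t" if "t \<in> {d..}" for t
      using that by (simp add: w_def min_absorb2)
    ultimately show ?thesis by (metis (no_types, lifting) has_integral_eq)
  qed
  ultimately have "(w has_integral (b * d powr p / p + d powr p)) ({0..d} \<union> {d..})"
  proof (rule has_integral_Un)
    have "{0..d} \<inter> {d..} = {d}" using d by auto
    then show "negligible ({0..d} \<inter> {d..})" by simp
  qed
  moreover have "{0..d} \<union> {d..} = {0..}" using d by auto
  \<comment> \<open>The two pieces add up because \<open>b + p = n\<close>.\<close>
  moreover have "b * d powr p / p + d powr p = n * d powr p / p"
    using p by (simp add: b_def field_simps)
  ultimately have int: "(w has_integral n * d powr p / p) {0..}" by simp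
  have "0 \<le> w t" if "t \<in> {0..}" for t
    using b d that by (auto simp: w_def)
  then have w: "(\<integral>\<^sup>+t. ennreal (w t) * indicator {0..} t \<partial>lborel) = ennreal (n * d powr p / p)"
    by (rule nn_integral_has_integral_lebesgue'[OF _ int])
  have "(\<integral>\<^sup>+h. G h * indicator {h. norm h \<le> d} h * ennreal (norm h powr (p - DIM('a))) \<partial>lborel) =
    (\<integral>\<^sup>+t. ennreal (b * t powr (- b - 1)) *
      (\<integral>\<^sup>+h. G h * indicator {h. norm h \<le> d} h * indicator {h. norm h \<le> t} h \<partial>lborel) \<partial>lborel)"
    using nn_integral_norm_powr_layers[of "\<lambda>h. G h * indicator {h. norm h \<le> d} h" b] b
    by (simp add: b_def n_def)
  also have "\<dots> = (\<integral>\<^sup>+t. ennreal (w t) * indicator {0..} t * C \<partial>lborel)"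
  proof (intro nn_integral_cong)
    fix t :: real
    have *: "(\<integral>\<^sup>+h. G h * indicator {h. norm h \<le> d} h * indicator {h. norm h \<le> t} h \<partial>lborel) =
        (\<integral>\<^sup>+h. G h * indicator {h. norm h \<le> min t d} h \<partial>lborel)"
      by (intro nn_integral_cong) (auto simp: indicator_def)
    consider "t < 0" | "t = 0" | "t > 0" by linarith
    then show "ennreal (b * t powr (- b - 1)) *
      (\<integral>\<^sup>+h. G h * indicator {h. norm h \<le> d} h * indicator {h. norm h \<le> t} h \<partial>lborel) =
      ennreal (w t) * indicator {0..} t * C"
    proof cases
      case 1
      then have "indicator {h. norm h \<le> t} h = (0::ennreal)" for h :: 'a
        using norm_ge_zero[of h] by (auto simp: indicator_def simp del: norm_ge_zero)
      with 1 show ?thesis by simp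
    next
      case 2
      then show ?thesis by (simp add: w_def)
    next
      case 3
      then have "(\<integral>\<^sup>+h. G h * indicator {h. norm h \<le> min t d} h \<partial>lborel) = ennreal (min t d ^ n) * C"
        using d unfolding C_def n_def by (intro nn_integral_cball_homogeneous hom) auto
      then show ?thesis
        using 3 b d unfolding * by (simp add: w_def ennreal_mult mult.assoc)
    qed
  qed
  also have "\<dots> = ennreal (n * d powr p / p) * C"
    unfolding w[symmetric] by (intro nn_integral_multc) (simp add: w_def)
  finally show ?thesis by (simp add: C_def n_def)
qed

text \<open>Layers with \<open>b = n + a\<close>: balls of radius below \<open>d\<close> contribute
  nothing, and the volume growth \<open>t ^ n\<close> of the larger ones leaves the tail
  \<open>t powr (- a - 1)\<close>, integrable at infinity.\<close>

lemma nn_integral_norm_powr_outside_cball_finite: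
  fixes a d :: real
  assumes d: "d > 0" and a: "a > 0"
  shows "(\<integral>\<^sup>+h. indicator {h :: 'a::euclidean_space. norm h > d} h *
    ennreal (norm h powr - (DIM('a) + a)) \<partial>lborel) < \<infinity>"
proof -
  define n where "n = DIM('a)"
  define b where "b = n + a"
  have b: "b > 0" using a by (simp add: b_def add_nonneg_pos)
  define C where "C = (\<integral>\<^sup>+h. 1 * indicator {h :: 'a. norm h \<le> 1} h \<partial>lborel)"
  have "C = emeasure lborel (cball 0 1 :: 'a set)"
    unfolding C_def by (simp add: cball_def dist_norm)
  then have C: "C < \<infinity>" using emeasure_lborel_cball_finite[of "0::'a" 1] by simp
  have "((\<lambda>t. b * t powr (- a - 1)) has_integral b * (- (d powr (- a - 1 + 1)) / (- a - 1 + 1))) {d..}"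
    using a d by (intro has_integral_mult_right has_integral_powr_to_inf) auto
  then have int: "(\<integral>\<^sup>+t. ennreal (b * t powr (- a - 1)) * indicator {d..} t \<partial>lborel) =
      ennreal (b * (- (d powr (- a - 1 + 1)) / (- a - 1 + 1)))"
    using b by (intro nn_integral_has_integral_lebesgue') auto
  have "(\<integral>\<^sup>+h. indicator {h :: 'a. norm h > d} h * ennreal (norm h powr - (DIM('a) + a)) \<partial>lborel) =
    (\<integral>\<^sup>+t. ennreal (b * t powr (- b - 1)) *
      (\<integral>\<^sup>+h. indicator {h. norm h > d} h * indicator {h :: 'a. norm h \<le> t} h \<partial>lborel) \<partial>lborel)"
    using nn_integral_norm_powr_layers[of "\<lambda>h :: 'a. indicator {h. norm h > d} h" b] b
    by (simp add: b_def n_def)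
  also have "\<dots> \<le> (\<integral>\<^sup>+t. ennreal (b * t powr (- a - 1)) * indicator {d..} t * C \<partial>lborel)"
  proof (intro nn_integral_mono)
    fix t :: real
    show "ennreal (b * t powr (- b - 1)) *
      (\<integral>\<^sup>+h. indicator {h. norm h > d} h * indicator {h :: 'a. norm h \<le> t} h \<partial>lborel)
      \<le> ennreal (b * t powr (- a - 1)) * indicator {d..} t * C"
    proof (cases "t < d")
      case True
      then have "indicator {h. norm h > d} h * indicator {h :: 'a. norm h \<le> t} h = (0::ennreal)" for h
        by (auto simp: indicator_def)
      then show ?thesis by (simp only: nn_integral_const) simp
    next
      case False
      then have t: "t > 0" using d by simp
      have "(\<integral>\<^sup>+h. indicator {h. norm h > d} h * indicator {h :: 'a. norm h \<le> t} h \<partial>lborel)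
          \<le> (\<integral>\<^sup>+h. 1 * indicator {h :: 'a. norm h \<le> t} h \<partial>lborel)"
        by (intro nn_integral_mono) (auto simp: indicator_def)
      also have "\<dots> = ennreal (t ^ n) * C"
        unfolding C_def n_def by (rule nn_integral_cball_homogeneous) (use t in auto)
      finally have "ennreal (b * t powr (- b - 1)) *
        (\<integral>\<^sup>+h. indicator {h. norm h > d} h * indicator {h :: 'a. norm h \<le> t} h \<partial>lborel)
        \<le> ennreal (b * t powr (- b - 1)) * (ennreal (t ^ n) * C)"
        by (rule mult_left_mono) simp
      also have "\<dots> = ennreal (b * t powr (- b - 1) * t ^ n) * C"
        using b t by (simp add: ennreal_mult mult.assoc)
      also have "b * t powr (- b - 1) * t ^ n = b * t powr (- a - 1)"
        using t by (simp add: powr_realpow[symmetric] powr_add[symmetric]) (simp add: b_def)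
      finally show ?thesis using False by simp
    qed
  qed
  also have "\<dots> = ennreal (b * (- (d powr (- a - 1 + 1)) / (- a - 1 + 1))) * C"
    unfolding int[symmetric] by (intro nn_integral_multc) simp
  also have "\<dots> < \<infinity>" using C by (simp add: ennreal_mult_less_top)
  finally show ?thesis .
qed

section \<open>Concentration at the origin as the exponent tends to 0\<close>

text \<open>Dominates all powers with exponent in \<open>[0, p']\<close> by a single function, which
  yields an estimate away from the origin that is uniform in \<open>p\<close>.\<close>

lemma powr_le_one_plus_powr:
  fixes r p p' :: real
  assumes "0 \<le> p" "p \<le> p'" "r \<ge> 0"
  shows "r powr p \<le> 1 + r powr p'"
proof (cases "r \<le> 1")
  case True
  then have "r powr p \<le> 1"
    using assms by (cases "r = 0") (auto intro!: powr_le1)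
  then show ?thesis by (simp add: add_increasing2)
next
  case False
  then show ?thesis using powr_mono[of p p' r] assms(2) by linarith
qed

text \<open>As \<open>p \<rightarrow> 0\<close> the measures \<open>p |h|\<^bsup>p - n\<^esup> dh\<close> concentrate at the origin, and there they see
  only the radial limit \<open>g\<close> of \<open>F\<close>.\<close>

lemma tendsto_weighted_integral_radial_limit:
  fixes F g :: "'a::euclidean_space \<Rightarrow> real" and M a B :: real
  defines "I \<equiv> \<lambda>p :: real. \<integral>\<^sup>+h. ennreal (F h * norm h powr (p - DIM('a))) \<partial>lborel"
  defines "S \<equiv> of_nat DIM('a) * (\<integral>\<^sup>+h. ennreal (g h) * indicator {h. norm h \<le> 1} h \<partial>lborel)"
  assumes [measurable]: "F \<in> borel_measurable borel" "g \<in> borel_measurable borel"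
    and F: "\<And>h. 0 \<le> F h" "\<And>h. F h \<le> M * norm h powr - a" and a: "a > 0"
    and g: "\<And>h. 0 \<le> g h" "\<And>h. g h \<le> B" "\<And>c h. c > 0 \<Longrightarrow> g (c *\<^sub>R h) = g h"
    and lim: "\<And>e. e > 0 \<Longrightarrow> \<exists>\<delta>>0. \<forall>h. h \<noteq> 0 \<and> norm h \<le> \<delta> \<longrightarrow> \<bar>F h - g h\<bar> \<le> e"
  shows "S < \<infinity>" "eventually (\<lambda>p. I p < \<infinity>) (at_right 0)"
    "((\<lambda>p. p * enn2real (I p)) \<longlongrightarrow> enn2real S) (at_right 0)"
proof -
  define n where "n = DIM('a)"
  have n: "n > 0" by (simp add: n_def)
  define U where "U G = (\<integral>\<^sup>+h. G h * indicator {h. norm h \<le> 1} h \<partial>lborel)" for G :: "'a \<Rightarrow> ennreal"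
  have "U (\<lambda>_. 1) = emeasure lborel (cball 0 1 :: 'a set)"
    unfolding U_def by (simp add: cball_def dist_norm)
  then have U1: "U (\<lambda>_. 1) < \<infinity>" using emeasure_lborel_cball_finite[of "0::'a" 1] by simp
  have B: "B \<ge> 0" using g(1,2)[of 0] by linarith
  have "U (\<lambda>h. ennreal (g h)) \<le> (\<integral>\<^sup>+h. ennreal B * (1 * indicator {h :: 'a. norm h \<le> 1} h) \<partial>lborel)"
    unfolding U_def using g B by (intro nn_integral_mono) (auto simp: indicator_def ennreal_leI)
  also have "\<dots> = ennreal B * U (\<lambda>_. 1)" by (simp add: U_def nn_integral_cmult)
  also have "\<dots> < \<infinity>" using U1 by (simp add: ennreal_mult_less_top)
  finally have Ug: "U (\<lambda>h. ennreal (g h)) < \<infinity>" .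
  \<comment> \<open>\<open>\<sigma>\<close> is the claimed limit as a real number;
    \<open>\<tau>\<close>, its analogue for the constant 1, is the area of the unit sphere and
    measures the error terms.\<close>
  define \<sigma> where "\<sigma> = n * enn2real (U (\<lambda>h. ennreal (g h)))"
  define \<tau> where "\<tau> = n * enn2real (U (\<lambda>_. 1))"
  have \<sigma>: "\<sigma> \<ge> 0" and \<tau>: "\<tau> \<ge> 0" by (auto simp: \<sigma>_def \<tau>_def)
  have S: "S = ennreal \<sigma>"
    using Ug by (simp add: S_def \<sigma>_def U_def[symmetric] n_def[symmetric] ennreal_mult
      ennreal_of_nat_eq_real_of_nat less_top)
  then show "S < \<infinity>" by simp
  have near: "(\<integral>\<^sup>+h. G h * indicator {h. norm h \<le> d} h * ennreal (norm h powr (p - n)) \<partial>lborel) =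
      ennreal (d powr p / p * (n * enn2real (U G)))"
    if "0 < p" "p < 1" "d > 0" "G \<in> borel_measurable borel" "\<And>c h. c > 0 \<Longrightarrow> G (c *\<^sub>R h) = G h" "U G < \<infinity>"
    for G :: "'a \<Rightarrow> ennreal" and d p :: real
  proof -
    have "1 \<le> DIM('a)" using n by (simp add: n_def)
    then have "p < DIM('a)" using that(2) by linarith
    then have "(\<integral>\<^sup>+h. G h * indicator {h. norm h \<le> d} h * ennreal (norm h powr (p - n)) \<partial>lborel) =
        ennreal (n * d powr p / p) * U G"
      unfolding n_def U_def using that by (intro nn_integral_homogeneous_norm_powr_cball) auto
    also have "U G = ennreal (enn2real (U G))" using that by (simp add: less_top)
    finally show ?thesis
      using that by (simp add: ennreal_mult[symmetric] mult_ac)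
  qed
  have near_g: "(\<integral>\<^sup>+h. ennreal (g h) * indicator {h. norm h \<le> d} h * ennreal (norm h powr (p - n)) \<partial>lborel) =
      ennreal (d powr p / p * \<sigma>)" if "0 < p" "p < 1" "d > 0" for p d :: real
    unfolding \<sigma>_def using that g Ug by (intro near) auto
  have near_1: "(\<integral>\<^sup>+h. 1 * indicator {h :: 'a. norm h \<le> d} h * ennreal (norm h powr (p - n)) \<partial>lborel) =
      ennreal (d powr p / p * \<tau>)" if "0 < p" "p < 1" "d > 0" for p d :: real
    unfolding \<tau>_def using that U1 by (intro near) auto
  have near_e: "(\<integral>\<^sup>+h. ennreal e * (1 * indicator {h :: 'a. norm h \<le> d} h * ennreal (norm h powr (p - n))) \<partial>lborel) =
      ennreal (d powr p / p * (e * \<tau>))" if "0 < p" "p < 1" "d > 0" "e > 0" for p d e :: real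
    using that \<tau> near_1[of p d] by (subst nn_integral_cmult) (simp_all add: ennreal_mult[symmetric] mult_ac)
  \<comment> \<open>The bound depends on \<open>d\<close> but not on \<open>p\<close>, so it
    disappears after multiplication by \<open>p\<close>. Restricting to \<open>p \<le> a / 2\<close>
    sacrifices only half of the decay of \<open>F\<close>.\<close>
  have far: "\<exists>C\<ge>0. \<forall>p. 0 < p \<and> p \<le> a / 2 \<longrightarrow>
      (\<integral>\<^sup>+h. indicator {h :: 'a. norm h > d} h * ennreal (F h * norm h powr (p - n)) \<partial>lborel) \<le> ennreal C"
    if d: "d > 0" for d :: real
  proof -
    have M: "M \<ge> 0"
    proof -
      obtain u :: 'a where "norm u = 1" using vector_choose_size[of 1] by auto
      then show ?thesis using F(1,2)[of u] by simp
    qed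
    define T where "T b = (\<integral>\<^sup>+h. indicator {h :: 'a. norm h > d} h * ennreal (norm h powr - (n + b)) \<partial>lborel)" for b :: real
    have T: "T b < \<infinity>" if "b > 0" for b
      unfolding T_def n_def by (rule nn_integral_norm_powr_outside_cball_finite[OF d that])
    define C where "C = ennreal M * (T a + T (a / 2))"
    have C: "C < \<infinity>" using T[of a] T[of "a / 2"] a by (simp add: C_def ennreal_mult_less_top)
    have "(\<integral>\<^sup>+h. indicator {h :: 'a. norm h > d} h * ennreal (F h * norm h powr (p - n)) \<partial>lborel) \<le> C"
      if p: "0 < p" "p \<le> a / 2" for p :: real
    proof -
      have "(\<integral>\<^sup>+h. indicator {h :: 'a. norm h > d} h * ennreal (F h * norm h powr (p - n)) \<partial>lborel) \<le>
        (\<integral>\<^sup>+h. ennreal M * (indicator {h :: 'a. norm h > d} h * ennreal (norm h powr - (n + a))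
           + indicator {h :: 'a. norm h > d} h * ennreal (norm h powr - (n + a / 2))) \<partial>lborel)"
      proof (intro nn_integral_mono)
        fix h :: 'a
        show "indicator {h. norm h > d} h * ennreal (F h * norm h powr (p - n)) \<le>
          ennreal M * (indicator {h. norm h > d} h * ennreal (norm h powr - (n + a))
           + indicator {h. norm h > d} h * ennreal (norm h powr - (n + a / 2)))"
        proof (cases "norm h > d")
          case True
          have "F h * norm h powr (p - n) \<le> M * norm h powr - a * norm h powr (p - n)"
            using F by (intro mult_right_mono) auto
          also have "\<dots> = M * (norm h powr p * norm h powr - (n + a))"
            by (simp add: powr_add[symmetric] algebra_simps)
          also have "\<dots> \<le> M * ((1 + norm h powr (a / 2)) * norm h powr - (n + a))"
            using M p by (intro mult_left_mono mult_right_mono powr_le_one_plus_powr) auto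
          also have "\<dots> = M * (norm h powr - (n + a) + norm h powr - (n + a / 2))"
            by (simp add: distrib_right powr_add[symmetric] minus_diff_commute)
          finally have "ennreal (F h * norm h powr (p - n)) \<le>
              ennreal (M * (norm h powr - (n + a) + norm h powr - (n + a / 2)))"
            by (rule ennreal_leI)
          then show ?thesis using True M by (simp add: ennreal_mult)
        qed simp
      qed
      also have "\<dots> = C"
        unfolding C_def T_def by (simp add: nn_integral_cmult nn_integral_add)
      finally show ?thesis .
    qed
    then show ?thesis using C
      by (intro exI[of _ "enn2real C"]) (auto simp: less_top)
  qed
  \<comment> \<open>Two-sided estimate: inside the ball of radius \<open>d\<close>, \<open>F\<close>
    is replaced by \<open>g\<close> at cost \<open>e\<close>; outside, \<open>far\<close> applies.
    The condition \<open>p < 1\<close> guarantees that \<open>p\<close> is below the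
    dimension.\<close>
  have bounds: "\<exists>d>0. \<exists>C\<ge>0. \<forall>p. 0 < p \<and> p \<le> a / 2 \<and> p < 1 \<longrightarrow>
      I p < \<infinity> \<and> p * enn2real (I p) \<le> d powr p * (\<sigma> + e * \<tau>) + p * C \<and>
      d powr p * \<sigma> \<le> p * enn2real (I p) + d powr p * (e * \<tau>)" if e: "e > 0" for e
  proof -
    obtain d where d: "d > 0" "\<And>h. h \<noteq> 0 \<Longrightarrow> norm h \<le> d \<Longrightarrow> \<bar>F h - g h\<bar> \<le> e"
      using lim[OF e] by blast
    obtain C where C: "C \<ge> 0" "\<And>p. 0 < p \<Longrightarrow> p \<le> a / 2 \<Longrightarrow>
      (\<integral>\<^sup>+h. indicator {h :: 'a. norm h > d} h * ennreal (F h * norm h powr (p - n)) \<partial>lborel) \<le> ennreal C"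
      using far[OF d(1)] by blast
    have "I p < \<infinity> \<and> p * enn2real (I p) \<le> d powr p * (\<sigma> + e * \<tau>) + p * C \<and>
      d powr p * \<sigma> \<le> p * enn2real (I p) + d powr p * (e * \<tau>)"
      if p: "0 < p" "p \<le> a / 2" "p < 1" for p
    proof -
      have "I p \<le> (\<integral>\<^sup>+h. ennreal (g h) * indicator {h. norm h \<le> d} h * ennreal (norm h powr (p - n)) +
          (ennreal e * (1 * indicator {h :: 'a. norm h \<le> d} h * ennreal (norm h powr (p - n))) +
          indicator {h :: 'a. norm h > d} h * ennreal (F h * norm h powr (p - n))) \<partial>lborel)"
        unfolding I_def n_def[symmetric]
      proof (intro nn_integral_mono)
        fix h :: 'a
        show "ennreal (F h * norm h powr (p - n)) \<le>
          ennreal (g h) * indicator {h. norm h \<le> d} h * ennreal (norm h powr (p - n)) +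
          (ennreal e * (1 * indicator {h :: 'a. norm h \<le> d} h * ennreal (norm h powr (p - n))) +
          indicator {h :: 'a. norm h > d} h * ennreal (F h * norm h powr (p - n)))"
        \<comment> \<open>At the origin, where closeness of \<open>F\<close> and \<open>g\<close> is
          not assumed, the weight is 0 since \<open>0 powr _\<close> is 0.\<close>
        proof (cases "h = 0 \<or> norm h > d")
          case True
          then show ?thesis by auto
        next
          case False
          then have "F h \<le> g h + e" using d(2)[of h] by auto
          then have "F h * norm h powr (p - n) \<le> (g h + e) * norm h powr (p - n)"
            by (intro mult_right_mono) auto
          then have "ennreal (F h * norm h powr (p - n)) \<le> ennreal ((g h + e) * norm h powr (p - n))"
            by (rule ennreal_leI)
          then show ?thesis using False g e by (simp add: ennreal_mult distrib_right)
        qed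
      qed
      also have "\<dots> = ennreal (d powr p / p * \<sigma>) + (ennreal (d powr p / p * (e * \<tau>)) +
          (\<integral>\<^sup>+h. indicator {h :: 'a. norm h > d} h * ennreal (F h * norm h powr (p - n)) \<partial>lborel))"
        using near_g[of p d] near_e[of p d e] p d(1) e by (simp add: nn_integral_add)
      also have "\<dots> \<le> ennreal (d powr p / p * \<sigma>) + (ennreal (d powr p / p * (e * \<tau>)) + ennreal C)"
        using p by (intro add_left_mono C) auto
      also have "\<dots> = ennreal (d powr p / p * \<sigma> + d powr p / p * (e * \<tau>) + C)"
        using p \<sigma> \<tau> e C(1) by (simp add: ennreal_plus[symmetric] add.assoc del: ennreal_plus)
      finally have upper: "I p \<le> ennreal (d powr p / p * \<sigma> + d powr p / p * (e * \<tau>) + C)" .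
      then have fin: "I p < \<infinity>" using ennreal_less_top by (simp add: le_less_trans)
      have "enn2real (I p) \<le> d powr p / p * \<sigma> + d powr p / p * (e * \<tau>) + C"
        using p \<sigma> \<tau> e C(1) by (intro enn2real_leI[OF _ upper]) simp
      then have up: "p * enn2real (I p) \<le> d powr p * (\<sigma> + e * \<tau>) + p * C"
        using p by (simp add: field_simps)
      \<comment> \<open>For the lower bound the error is added to \<open>F\<close> rather than
        subtracted from \<open>g\<close>, which avoids truncated subtraction in
        \<open>ennreal\<close>.\<close>
      have "ennreal (d powr p / p * \<sigma>) \<le> (\<integral>\<^sup>+h. ennreal (F h * norm h powr (p - n)) +
          ennreal e * (1 * indicator {h :: 'a. norm h \<le> d} h * ennreal (norm h powr (p - n))) \<partial>lborel)"
        unfolding near_g[OF p(1,3) d(1), symmetric]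
      proof (intro nn_integral_mono)
        fix h :: 'a
        show "ennreal (g h) * indicator {h. norm h \<le> d} h * ennreal (norm h powr (p - n)) \<le>
          ennreal (F h * norm h powr (p - n)) +
          ennreal e * (1 * indicator {h :: 'a. norm h \<le> d} h * ennreal (norm h powr (p - n)))"
        proof (cases "h = 0 \<or> norm h > d")
          case True
          then show ?thesis by auto
        next
          case False
          then have "g h \<le> F h + e" using d(2)[of h] by auto
          then have "g h * norm h powr (p - n) \<le> (F h + e) * norm h powr (p - n)"
            by (intro mult_right_mono) auto
          then have "ennreal (g h * norm h powr (p - n)) \<le> ennreal ((F h + e) * norm h powr (p - n))"
            by (rule ennreal_leI)
          then show ?thesis using False g F(1) e by (simp add: ennreal_mult distrib_right)
        qed
      qed
      also have "\<dots> = I p + ennreal (d powr p / p * (e * \<tau>))"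
        using near_e[of p d e] p d(1) e by (simp add: nn_integral_add I_def n_def)
      also have "\<dots> = ennreal (enn2real (I p) + d powr p / p * (e * \<tau>))"
        using fin p \<tau> e by (simp add: less_top)
      finally have "d powr p / p * \<sigma> \<le> enn2real (I p) + d powr p / p * (e * \<tau>)"
        using p \<tau> e by (subst (asm) ennreal_le_iff) auto
      then have "d powr p * \<sigma> \<le> p * enn2real (I p) + d powr p * (e * \<tau>)"
        using p by (simp add: field_simps)
      with fin up show ?thesis by simp
    qed
    then show ?thesis using d(1) C(1) by blast
  qed
  have small: "eventually (\<lambda>p. 0 < p \<and> p \<le> a / 2 \<and> p < 1) (at_right (0::real))"
    using a by (auto simp: eventually_at_right_field intro!: exI[of _ "min (a / 2) 1"])
  show "eventually (\<lambda>p. I p < \<infinity>) (at_right 0)"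
    using bounds[of 1] small by (auto elim: eventually_mono)
  have powr_lim: "((\<lambda>p. d powr p) \<longlongrightarrow> 1) (at_right 0)" if "d > 0" for d :: real
    using that by (auto intro!: tendsto_eq_intros)
  have "((\<lambda>p. p * enn2real (I p)) \<longlongrightarrow> \<sigma>) (at_right 0)"
  proof (rule tendstoI)
    fix \<epsilon> :: real assume \<epsilon>: "\<epsilon> > 0"
    \<comment> \<open>\<open>e\<close>, and with it \<open>d\<close> and \<open>C\<close>, is fixed
      before \<open>p\<close> tends to 0. Then \<open>d powr p\<close> tends to 1 and
      \<open>p * C\<close> to 0, so the bounds tend to \<open>\<sigma> + e * \<tau>\<close> and
      \<open>\<sigma> - e * \<tau>\<close>, strictly within \<open>\<epsilon>\<close> of
      \<open>\<sigma>\<close>.\<close>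
    define e where "e = \<epsilon> / (\<tau> + 1)"
    have e: "e > 0" "e * \<tau> < \<epsilon>" using \<epsilon> \<tau> by (auto simp: e_def field_simps)
    obtain d C where d: "d > 0" and C: "\<And>p. 0 < p \<and> p \<le> a / 2 \<and> p < 1 \<Longrightarrow>
      p * enn2real (I p) \<le> d powr p * (\<sigma> + e * \<tau>) + p * C \<and>
      d powr p * \<sigma> \<le> p * enn2real (I p) + d powr p * (e * \<tau>)"
      using bounds[OF e(1)] by blast
    have "((\<lambda>p. d powr p * (\<sigma> + e * \<tau>) + p * C) \<longlongrightarrow> 1 * (\<sigma> + e * \<tau>) + 0 * C) (at_right 0)"
      by (intro tendsto_intros powr_lim d)
    then have "eventually (\<lambda>p. d powr p * (\<sigma> + e * \<tau>) + p * C < \<sigma> + \<epsilon>) (at_right 0)"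
      using e(2) by (intro order_tendstoD(2)) auto
    moreover have "((\<lambda>p. d powr p * \<sigma> - d powr p * (e * \<tau>)) \<longlongrightarrow> 1 * \<sigma> - 1 * (e * \<tau>)) (at_right 0)"
      by (intro tendsto_intros powr_lim d)
    then have "eventually (\<lambda>p. d powr p * \<sigma> - d powr p * (e * \<tau>) > \<sigma> - \<epsilon>) (at_right 0)"
      using e(2) by (intro order_tendstoD(1)) auto
    ultimately show "eventually (\<lambda>p. dist (p * enn2real (I p)) \<sigma> < \<epsilon>) (at_right 0)"
      using small
    proof eventually_elim
      case (elim p)
      then show ?case using C[of p] by (auto simp: dist_real_def abs_less_iff)
    qed
  qed
  then show "((\<lambda>p. p * enn2real (I p)) \<longlongrightarrow> enn2real S) (at_right 0)"
    using \<sigma> by (simp add: S)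
qed

section \<open>The limit of the fractional derivative\<close>

lemma Ckc_bounded:
  fixes f :: "real^'n::finite \<Rightarrow> real"
  assumes "Ckc k f"
  shows "\<exists>B. \<forall>y. \<bar>f y\<bar> \<le> B"
proof -
  let ?K = "closure {y. f y \<noteq> 0}"
  have "partial_derivatives [] f = f" by (simp add: partial_derivatives_def)
  then have "continuous_on UNIV f"
    using assms unfolding Ckc_def Ck_def by (metis bot_nat_0.extremum list.size(3))
  then have "bounded (f ` ?K)"
    using assms unfolding Ckc_def
    by (intro compact_imp_bounded compact_continuous_image) (auto intro: continuous_on_subset)
  then obtain B where B: "\<And>y. y \<in> ?K \<Longrightarrow> \<bar>f y\<bar> \<le> B"
    by (auto simp: bounded_iff)
  have "\<bar>f y\<bar> \<le> max 0 B" for y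
    using B[of y] closure_subset[of "{y. f y \<noteq> 0}"] by (cases "f y = 0") auto
  then show ?thesis by blast
qed

text \<open>The absolute values of the coefficients sum to \<open>2 ^ k\<close>.\<close>

lemma finite_difference_bounded:
  assumes "\<And>y. \<bar>f y\<bar> \<le> B"
  shows "\<bar>finite_difference k h f x\<bar> \<le> 2 ^ k * B"
proof -
  have "\<bar>finite_difference k h f x\<bar> \<le> (\<Sum>j\<le>k. real (k choose j) * B)"
    unfolding finite_difference_def
    by (intro order_trans[OF sum_abs] sum_mono) (auto simp: abs_mult assms intro!: mult_left_mono)
  also have "\<dots> = real (\<Sum>j\<le>k. k choose j) * B" by (simp add: sum_distrib_right)
  finally show ?thesis by (simp add: choose_row_sum)
qed

text \<open>Change of variables for the image measure under \<open>sgn\<close>; the deleted origin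
  is a null set. This identifies the solid integral over the unit ball in the radial limit with a
  surface integral.\<close>

lemma nn_integral_sphere_measure:
  fixes G :: "real^'n::finite \<Rightarrow> ennreal"
  assumes G [measurable]: "G \<in> borel_measurable borel"
  shows "(\<integral>\<^sup>+\<theta>. G \<theta> \<partial>sphere_measure) =
    of_nat CARD('n) * (\<integral>\<^sup>+h. G (sgn h) * indicator {h. norm h \<le> 1} h \<partial>lborel)"
proof -
  let ?B = "cball 0 1 - {0} :: (real^'n) set"
  let ?S = "restrict_space borel (sphere 0 1) :: (real^'n) measure"
  have "sgn \<in> borel_measurable (borel :: (real^'n) measure)"
    unfolding sgn_div_norm[abs_def] by measurable
  then have sgn: "sgn \<in> restrict_space lborel ?B \<rightarrow>\<^sub>M ?S"
    by (intro measurable_restrict_space2 measurable_restrict_space1)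
       (auto simp: space_restrict_space norm_sgn)
  have G': "G \<in> borel_measurable ?S"
    by (rule measurable_restrict_space1[OF G])
  have "(\<integral>\<^sup>+\<theta>. G \<theta> \<partial>sphere_measure) = of_nat CARD('n) * (\<integral>\<^sup>+h. G (sgn h) * indicator ?B h \<partial>lborel)"
    unfolding sphere_measure_def
    using G' by (simp add: nn_integral_scale_measure nn_integral_distr[OF sgn] nn_integral_restrict_space)
  also have "(\<integral>\<^sup>+h. G (sgn h) * indicator ?B h \<partial>lborel) =
      (\<integral>\<^sup>+h. G (sgn h) * indicator {h. norm h \<le> 1} h \<partial>lborel)"
    by (intro nn_integral_cong_AE, use AE_lborel_singleton[of "0 :: real^'n"] in eventually_elim)
       (simp add: indicator_def)
  finally show ?thesis .
qed

lemma ennreal_root_scaled: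
  assumes "p \<ge> 0" "I < \<infinity>"
  shows "ennreal (p powr (1 / q)) * ennreal_root q I = ennreal ((p * enn2real I) powr (1 / q))"
  using assms by (simp add: ennreal_root_def less_top ennreal_mult[symmetric] powr_mult)

theorem theorem3p13:
  fixes k :: nat and q :: real and f :: "real^'n::finite \<Rightarrow> real" and x :: "real^'n"
  assumes "k \<ge> 1" and "0 < q" and "Ckc k f"
  shows "((\<lambda>s. ennreal ((q * (1 - s)) powr (1 / q)) * fractional_derivative k s q f x)
           \<longlongrightarrow> form_norm k q (derivative_form k f x)) (at_left (1::real))"
proof -
  define D where "D h = derivative_form k f x (replicate k h)" for h
  \<comment> \<open>The exponent \<open>n + (k - 1 + s) * q\<close> equals
    \<open>k * q + (n - p)\<close> with \<open>p = q * (1 - s)\<close>. \<open>F\<close> absorbs the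
    first part, which makes it independent of \<open>s\<close> and gives it the radial limit
    \<open>g\<close>; \<open>I p\<close> carries the rest.\<close>
  define F where "F h = \<bar>finite_difference k h f x\<bar> powr q * norm h powr - (k * q)" for h
  define g where "g h = \<bar>D (sgn h)\<bar> powr q" for h
  define I where "I p = (\<integral>\<^sup>+h. ennreal (F h * norm h powr (p - DIM(real^'n))) \<partial>lborel)" for p :: real
  define S where "S = of_nat DIM(real^'n) * (\<integral>\<^sup>+h. ennreal (g h) * indicator {h. norm h \<le> 1} h \<partial>lborel)"
  have Ck: "Ck k f" using assms(3) by (simp add: Ckc_def)
  have contf: "continuous_on UNIV f"
    using Ck unfolding Ck_def partial_derivatives_def by (auto dest!: spec[of _ "[]"])
  have "continuous_on UNIV (\<lambda>h. finite_difference k h f x)"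
    unfolding finite_difference_def
    by (intro continuous_intros continuous_on_compose2[OF contf]) auto
  then have [measurable]: "(\<lambda>h. finite_difference k h f x) \<in> borel_measurable borel"
    by (rule borel_measurable_continuous_onI)
  have contD: "continuous_on UNIV D"
    unfolding D_def by (rule continuous_on_derivative_form_replicate)
  then have [measurable]: "D \<in> borel_measurable borel"
    by (rule borel_measurable_continuous_onI)
  have sgn [measurable]: "sgn \<in> borel_measurable (borel :: (real^'n) measure)"
    unfolding sgn_div_norm[abs_def] by measurable
  have measF: "F \<in> borel_measurable borel"
    unfolding F_def[abs_def] by measurable
  have measg: "g \<in> borel_measurable borel"
    unfolding g_def[abs_def] by measurable
  obtain B where B: "\<And>y. \<bar>f y\<bar> \<le> B" using Ckc_bounded[OF assms(3)] by blast
  have F_le: "F h \<le> (2 ^ k * B) powr q * norm h powr - (k * q)" for h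
    unfolding F_def using finite_difference_bounded[OF B, where k = k and h = h and x = x] assms(2)
    by (intro mult_right_mono powr_mono2) auto
  have "bounded (D ` cball 0 1)"
    by (intro compact_imp_bounded compact_continuous_image continuous_on_subset[OF contD]) auto
  then obtain R where R: "\<And>h. norm h \<le> 1 \<Longrightarrow> \<bar>D h\<bar> \<le> R"
    unfolding bounded_iff by (metis image_eqI mem_cball_0 real_norm_def)
  have D_sgn: "\<bar>D (sgn h)\<bar> \<le> R" for h
    by (rule R) (simp add: norm_sgn)
  have g_le: "g h \<le> R powr q" for h
    unfolding g_def using D_sgn[of h] assms(2) by (intro powr_mono2) auto
  have g_hom: "g (c *\<^sub>R h) = g h" if "c > 0" for c h
    using that by (simp add: g_def sgn_scaleR)
  have lim: "\<exists>\<delta>>0. \<forall>h. h \<noteq> 0 \<and> norm h \<le> \<delta> \<longrightarrow> \<bar>F h - g h\<bar> \<le> e" if e: "e > 0" for e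
  proof -
    \<comment> \<open>Uniform continuity on a compact interval treats all \<open>q > 0\<close>
      alike, including \<open>q < 1\<close>, where the function is not Lipschitz at 0. The extra 1
      leaves room for the normalised difference \<open>u\<close>, which lies within
      \<open>\<epsilon> \<le> 1\<close> of a value bounded by \<open>R\<close>.\<close>
    have "continuous_on {-(R + 1)..R + 1} (\<lambda>t :: real. \<bar>t\<bar> powr q)"
      using assms(2) by (intro continuous_on_powr' continuous_intros) auto
    then have "uniformly_continuous_on {-(R + 1)..R + 1} (\<lambda>t :: real. \<bar>t\<bar> powr q)"
      by (intro compact_uniformly_continuous) auto
    then obtain \<eta> where \<eta>: "\<eta> > 0" "\<And>u v. u \<in> {-(R + 1)..R + 1} \<Longrightarrow> v \<in> {-(R + 1)..R + 1} \<Longrightarrow>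
        dist u v < \<eta> \<Longrightarrow> dist (\<bar>u\<bar> powr q) (\<bar>v\<bar> powr q) < e"
      using e unfolding uniformly_continuous_on_def by metis
    define \<epsilon> where "\<epsilon> = min 1 (\<eta> / 2)"
    have \<epsilon>: "\<epsilon> > 0" "\<epsilon> \<le> 1" "\<epsilon> < \<eta>" using \<eta>(1) by (auto simp: \<epsilon>_def)
    obtain \<delta> where \<delta>: "\<delta> > 0"
      "\<And>h. norm h \<le> \<delta> \<Longrightarrow> \<bar>finite_difference k h f x - D h\<bar> \<le> \<epsilon> * norm h ^ k"
      using finite_difference_asymp_derivative_form[OF Ck \<epsilon>(1)] unfolding D_def by blast
    have "\<bar>F h - g h\<bar> \<le> e" if h: "h \<noteq> 0" "norm h \<le> \<delta>" for h
    proof -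
      define u where "u = finite_difference k h f x / norm h ^ k"
      have "D h = norm h ^ k * D (sgn h)"
        using derivative_form_replicate_scaleR[where m = k and f = f and y = x and r = "norm h" and h = "sgn h"] h
        by (simp add: D_def sgn_div_norm)
      then have "u - D (sgn h) = (finite_difference k h f x - D h) / norm h ^ k"
        using h by (simp add: u_def diff_divide_distrib)
      then have "\<bar>u - D (sgn h)\<bar> = \<bar>finite_difference k h f x - D h\<bar> / norm h ^ k"
        by (simp add: abs_divide)
      also have "\<dots> \<le> \<epsilon>" using \<delta>(2)[OF h(2)] h(1) by (simp add: field_simps)
      finally have u: "\<bar>u - D (sgn h)\<bar> \<le> \<epsilon>" .
      have "(norm h ^ k) powr q = norm h powr (k * q)"
        using h by (simp add: powr_realpow[symmetric] powr_powr)
      then have "F h = \<bar>u\<bar> powr q"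
        by (simp add: F_def u_def abs_divide powr_divide powr_minus_divide)
      moreover have "dist (\<bar>u\<bar> powr q) (\<bar>D (sgn h)\<bar> powr q) < e"
        using u D_sgn[of h] \<epsilon> by (intro \<eta>(2)) (auto simp: dist_real_def)
      ultimately show ?thesis by (simp add: g_def dist_real_def)
    qed
    then show ?thesis using \<delta>(1) by blast
  qed
  \<comment> \<open>This is the decay exponent \<open>a\<close> of the radial limit; its positivity
    comes from \<open>k \<ge> 1\<close>.\<close>
  have kq: "real k * q > 0" using assms by simp
  note radial = tendsto_weighted_integral_radial_limit
    [OF measF measg _ F_le kq _ g_le g_hom lim, folded I_def S_def]
  have nonneg: "0 \<le> F h" "0 \<le> g h" for h by (auto simp: F_def g_def)
  have sub: "filterlim (\<lambda>s. q * (1 - s)) (at_right 0) (at_left (1::real))"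
  proof -
    have "((\<lambda>s. q * (1 - s)) \<longlongrightarrow> q * (1 - 1)) (at_left (1::real))"
      by (intro tendsto_intros)
    moreover have "eventually (\<lambda>s. q * (1 - s) \<in> {0<..} \<and> q * (1 - s) \<noteq> 0) (at_left (1::real))"
      using assms(2) by (auto simp: eventually_at_left_field intro!: exI[of _ 0])
    ultimately show ?thesis by (simp add: filterlim_at)
  qed
  \<comment> \<open>Since \<open>enn2real\<close> sends infinity to 0, a limit of real values alone
    does not control the extended ones; finiteness near \<open>s = 1\<close> permits the translation
    back.\<close>
  have fin: "eventually (\<lambda>s. I (q * (1 - s)) < \<infinity>) (at_left 1)"
    using radial(2)[OF nonneg] sub by (auto simp: filterlim_iff)
  have "((\<lambda>s. q * (1 - s) * enn2real (I (q * (1 - s)))) \<longlongrightarrow> enn2real S) (at_left 1)"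
    using filterlim_compose[OF radial(3)[OF nonneg] sub] .
  then have "((\<lambda>s. ennreal ((q * (1 - s) * enn2real (I (q * (1 - s)))) powr (1 / q))) \<longlongrightarrow>
      ennreal (enn2real S powr (1 / q))) (at_left 1)"
  \<comment> \<open>The limit of the base may be 0, so continuity of the power there rests on the
    positive exponent \<open>1 / q\<close> and a nonnegative base.\<close>
  proof (intro tendsto_ennrealI tendsto_powr2)
    show "\<forall>\<^sub>F s in at_left 1. 0 \<le> q * (1 - s) * enn2real (I (q * (1 - s)))"
      using assms(2) by (auto simp: eventually_at_left_field intro!: exI[of _ 0])
  qed (use assms(2) in auto)
  moreover have "form_norm k q (derivative_form k f x) = ennreal (enn2real S powr (1 / q))"
  proof -
    have "(\<integral>\<^sup>+\<theta>. ennreal (\<bar>derivative_form k f x (replicate k \<theta>)\<bar> powr q) \<partial>sphere_measure) = S"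
      unfolding D_def[symmetric] by (subst nn_integral_sphere_measure) (simp_all add: S_def g_def)
    then show ?thesis
      using radial(1)[OF nonneg] by (simp add: form_norm_def ennreal_root_def less_top)
  qed
  moreover have "eventually (\<lambda>s. ennreal ((q * (1 - s) * enn2real (I (q * (1 - s)))) powr (1 / q)) =
      ennreal ((q * (1 - s)) powr (1 / q)) * fractional_derivative k s q f x) (at_left 1)"
    using fin eventually_at_left_real[of 0 "1::real", OF zero_less_one]
  proof eventually_elim
    case (elim s)
    have "\<bar>finite_difference k h f x\<bar> powr q / norm h powr (real CARD('n) + (real k - 1 + s) * q) =
        F h * norm h powr (q * (1 - s) - DIM(real^'n))" for h
    proof -
      have "- (real CARD('n) + (real k - 1 + s) * q) = - (k * q) + (q * (1 - s) - DIM(real^'n))"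
        by (simp add: algebra_simps)
      then have "norm h powr - (real CARD('n) + (real k - 1 + s) * q) =
          norm h powr - (k * q) * norm h powr (q * (1 - s) - DIM(real^'n))"
        by (simp only: powr_add)
      then show ?thesis
        unfolding F_def by (simp only: powr_minus divide_inverse mult.assoc)
    qed
    then have "fractional_derivative k s q f x = ennreal_root q (I (q * (1 - s)))"
      by (simp add: fractional_derivative_def I_def)
    then show ?case
      using elim assms(2) by (simp add: ennreal_root_scaled)
  qed
  ultimately show ?thesis by (simp only: Lim_transform_eventually)
qed

end
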